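(* Let $n\ge1$ and $a,b>0$. The strong Viterbo conjecture holds for $P_L^{2n}(a,b)=\{(q,p)\in\mathbb{R}^n\times\mathbb{R}^n\mid\|q\|<a,\ \|p\|<b\}$; that is, all normalized symplectic capacities of $P_L^{2n}(a,b)$ are equal: if $c$ and $c'$ are normalized symplectic capacities on $\mathbb{R}^{2n}$, then $c(P_L^{2n}(a,b))=c'(P_L^{2n}(a,b))$.
   Context: $\mathbb{R}^{2n}=\mathbb{R}^n\times\mathbb{R}^n$ has the symplectic form $\omega_{st}=\sum dq_i\wedge dp_i$, and $B^{2n}(r)$ is the standard ball of radius $r$. A normalized symplectic capacity is a map $c$ from the set of subsets of $\mathbb{R}^{2n}$ to $[0,+\infty]$ such that: (Conformality) $c(sX)=s^2c(X)$ for scalars $s>0$; (Monotonicity) if there is a symplectic embedding $\psi:X_1\to X_2$ then $c(X_1)\le c(X_2)$; (Normalization) $c(B^{2n}(1))=c(B^2(1)\times\mathbb{R}^{2n-2})=\pi$, where $B^2(1)$ is the unit disc in the symplectic $(q_1,p_1)$-plane. *)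

theory Defs
  imports "HOL-Analysis.Analysis"
begin

text \<open>
  The space \<open>(real ^ 'n) \<times> (real ^ 'n)\<close> is \<open>\<real>\<^sup>2\<^sup>n\<close> with coordinates \<open>(q, p)\<close>; the product norm is
  the Euclidean one, so \<open>ball 0 r\<close> is the standard (open) ball.
\<close>

type_synonym 'n phase = "(real ^ 'n) \<times> (real ^ 'n)"

definition omega_st :: "'n::finite phase \<Rightarrow> 'n phase \<Rightarrow> real" where
  "omega_st v w = (\<Sum>i\<in>UNIV. fst v $ i * snd w $ i - snd v $ i * fst w $ i)"

text \<open>
  \<open>Ck_on k U f\<close> is meant for open \<open>U\<close>: all directional derivatives of order at most \<open>k\<close> exist
  as Frechet derivatives and are continuous.
\<close>

primrec Ck_on ::
  "nat \<Rightarrow> 'a::real_normed_vector set \<Rightarrow> ('a \<Rightarrow> 'b::real_normed_vector) \<Rightarrow> bool" where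
  "Ck_on 0 U f \<longleftrightarrow> continuous_on U f"
| "Ck_on (Suc k) U f \<longleftrightarrow>
     (\<forall>x\<in>U. f differentiable (at x)) \<and>
     (\<forall>v. Ck_on k U (\<lambda>x. frechet_derivative f (at x) v))"

definition smooth_on :: "'a::real_normed_vector set \<Rightarrow> ('a \<Rightarrow> 'b::real_normed_vector) \<Rightarrow> bool" where
  "smooth_on U f \<longleftrightarrow> (\<forall>k. Ck_on k U f)"

text \<open>
  A smooth embedding of an open set that pulls \<open>omega_st\<close> back to itself. It is automatically an
  immersion, since \<open>omega_st\<close> is nondegenerate.
\<close>

definition open_symplectic_embedding ::
  "'n::finite phase set \<Rightarrow> ('n phase \<Rightarrow> 'n phase) \<Rightarrow> bool" where
  "open_symplectic_embedding U f \<longleftrightarrow>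
     open U \<and> smooth_on U f \<and> (\<exists>g. homeomorphism U (f ` U) f g) \<and>
     (\<forall>x\<in>U. \<forall>v w. omega_st (frechet_derivative f (at x) v) (frechet_derivative f (at x) w)
                    = omega_st v w)"

text \<open>
  For an arbitrary subset \<open>X\<close>, a symplectic embedding is one that extends to a symplectic
  embedding of an open neighbourhood of \<open>X\<close>. For open \<open>X\<close> the extension is no restriction. For
  other sets this is the narrowest of the usual conventions, hence imposes the least on a capacity.
\<close>

definition symplectic_embedding ::
  "'n::finite phase set \<Rightarrow> 'n phase set \<Rightarrow> ('n phase \<Rightarrow> 'n phase) \<Rightarrow> bool" where
  "symplectic_embedding X Y f \<longleftrightarrow>
     f ` X \<subseteq> Y \<and>
     (\<exists>U g. X \<subseteq> U \<and> open_symplectic_embedding U g \<and> (\<forall>x\<in>X. g x = f x))"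

definition symplectic_cylinder :: "'n::finite \<Rightarrow> 'n phase set" where
  "symplectic_cylinder i = {(q, p). (q $ i)\<^sup>2 + (p $ i)\<^sup>2 < 1}"

text \<open>
  The index type has no distinguished first element, so the index \<open>i\<close> of the coordinate pair
  \<open>(q\<^sub>1, p\<^sub>1)\<close> singled out by the normalization is a parameter. Taking the open ball and the open
  cylinder is immaterial: conformality and monotonicity give their closures the same value.
\<close>

definition normalized_symplectic_capacity ::
  "'n::finite \<Rightarrow> ('n phase set \<Rightarrow> ennreal) \<Rightarrow> bool" where
  "normalized_symplectic_capacity i c \<longleftrightarrow>
     (\<forall>s X. s > 0 \<longrightarrow> c ((\<lambda>x. s *\<^sub>R x) ` X) = ennreal (s\<^sup>2) * c X) \<and>
     (\<forall>X Y. (\<exists>f. symplectic_embedding X Y f) \<longrightarrow> c X \<le> c Y) \<and>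
     c (ball 0 1) = ennreal pi \<and>
     c (symplectic_cylinder i) = ennreal pi"

definition lagrangian_ball_product :: "real \<Rightarrow> real \<Rightarrow> 'n::finite phase set" where
  "lagrangian_ball_product a b = {(q, p). norm q < a \<and> norm p < b}"

end

theory Submission
  imports Defs
begin

text \<open>
  The common value is \<open>4ab\<close>. Dilations \<open>(q, p) \<mapsto> (tq, p/t)\<close> and conformality show that the capacity
  of the product is proportional to \<open>ab\<close>, so it suffices to treat radii \<open>\<pi>/4\<close> and \<open>1\<close>. Both bounds
  come from cotangent lifts. For \<open>\<alpha> > \<pi>/4\<close>, let \<open>F\<close> be radial with radial part slightly steeper than
  \<open>\<integral>\<^sub>0\<^sup>r sqrt (1 - u\<^sup>2) du\<close>; then \<open>DF q\<close> has eigenvalues at least \<open>sqrt (1 - |q|\<^sup>2)\<close>, and its lift takes the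
  unit ball into the product with radii \<open>\<alpha>\<close> and \<open>1\<close>. Conversely, with \<open>X\<close> the inverse of
  \<open>y \<mapsto> \<integral>\<^sub>0\<^sup>y sqrt (1 - u\<^sup>2) du\<close>, the lift of \<open>X\<close> applied in each coordinate takes the product
  with radii \<open>\<pi>/4\<close> and \<open>1\<close> into the cylinder, because the image of \<open>p\<^sub>i\<close> is \<open>p\<^sub>i sqrt (1 - X(q\<^sub>i)\<^sup>2)\<close>.
\<close>

section \<open>Smooth functions\<close>

text \<open>\<open>frechet_derivative\<close> is a choice determined by the predicate
  \<open>has_derivative\<close>, and at a point of an open set that predicate sees only nearby
  values.\<close>

lemma Ck_on_cong:
  assumes "open U" "\<And>x. x \<in> U \<Longrightarrow> f x = g x"
  shows "Ck_on k U f = Ck_on k U g"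
  using assms(2)
proof (induction k arbitrary: f g)
  case 0
  then show ?case by (simp cong: continuous_on_cong)
next
  case (Suc k)
  have der: "(f has_derivative D) (at x) = (g has_derivative D) (at x)" if "x \<in> U" for D x
    using has_derivative_transform_within_open[of f D x UNIV U g]
      has_derivative_transform_within_open[of g D x UNIV U f] \<open>open U\<close> that Suc.prems by auto
  then have "frechet_derivative f (at x) = frechet_derivative g (at x)"
    and "f differentiable (at x) \<longleftrightarrow> g differentiable (at x)" if "x \<in> U" for x
    using that by (simp_all add: frechet_derivative_def differentiable_def)
  moreover from this(1)
  have "Ck_on k U (\<lambda>x. frechet_derivative f (at x) v) =
      Ck_on k U (\<lambda>x. frechet_derivative g (at x) v)" for v
    using Suc.IH[of "\<lambda>x. frechet_derivative f (at x) v" "\<lambda>x. frechet_derivative g (at x) v"]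
    by simp
  ultimately show ?case by simp
qed

text \<open>Lets an explicit derivative stand in for the one selected by
  \<open>frechet_derivative\<close>; the calculus rules below are proved through it.\<close>

lemma Ck_on_Suc:
  assumes "open U" "\<And>x. x \<in> U \<Longrightarrow> (f has_derivative f' x) (at x)"
    and "\<And>v. Ck_on k U (\<lambda>x. f' x v)"
  shows "Ck_on (Suc k) U f"
proof -
  have "f' x = frechet_derivative f (at x)" if "x \<in> U" for x
    using frechet_derivative_at assms(2) that by blast
  then have "Ck_on k U (\<lambda>x. frechet_derivative f (at x) v)" for v
    using Ck_on_cong[OF assms(1), of "\<lambda>x. frechet_derivative f (at x) v" "\<lambda>x. f' x v" k] assms(3)
    by simp
  then show ?thesis
    using assms(2) by (auto simp: differentiable_def)
qed

text \<open>Needed because product and chain rules leave some factors undifferentiated, and these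
  must drop to the lower order.\<close>

lemma Ck_on_SucD: "Ck_on (Suc k) U f \<Longrightarrow> Ck_on k U f"
proof (induction k arbitrary: f)
  case 0
  then show ?case
    by (simp add: continuous_at_imp_continuous_on differentiable_imp_continuous_within)
next
  case (Suc k)
  have "f differentiable (at x)" if "x \<in> U" for x
    using Suc.prems that by simp
  moreover have "Ck_on (Suc k) U (\<lambda>x. frechet_derivative f (at x) v)" for v
    using Suc.prems Ck_on.simps(2)[of "Suc k" U f] by blast
  ultimately show ?case
    using Suc.IH by simp
qed

lemma Ck_on_has_derivative:
  "Ck_on (Suc k) U f \<Longrightarrow> x \<in> U \<Longrightarrow> (f has_derivative frechet_derivative f (at x)) (at x)"
  by (simp add: frechet_derivative_works)

lemma Ck_on_const:
  assumes "open U"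
  shows "Ck_on k U (\<lambda>x. c)"
proof (induction k arbitrary: c)
  case (Suc k)
  show ?case
    by (rule Ck_on_Suc[OF assms, where f' = "\<lambda>_ _. 0"]) (auto intro: Suc)
qed simp

lemma Ck_on_bounded_linear:
  assumes "open U" "bounded_linear f"
  shows "Ck_on k U f"
proof (cases k)
  case 0
  then show ?thesis using assms by (simp add: linear_continuous_on)
next
  case (Suc l)
  then show ?thesis
    using Ck_on_Suc[of U f "\<lambda>_. f" l] assms Ck_on_const bounded_linear_imp_has_derivative
    by blast
qed

lemma Ck_on_add:
  assumes "open U" "Ck_on k U f" "Ck_on k U g"
  shows "Ck_on k U (\<lambda>x. f x + g x)"
  using assms(2,3)
proof (induction k arbitrary: f g)
  case 0
  then show ?case by (auto intro: continuous_on_add)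
next
  case (Suc k)
  show ?case
  proof (rule Ck_on_Suc[OF assms(1)])
    fix x assume "x \<in> U"
    then show "((\<lambda>x. f x + g x) has_derivative
        (\<lambda>v. frechet_derivative f (at x) v + frechet_derivative g (at x) v)) (at x)"
      using Suc.prems by (intro has_derivative_add Ck_on_has_derivative)
  next
    show "Ck_on k U (\<lambda>x. frechet_derivative f (at x) v + frechet_derivative g (at x) v)" for v
      using Suc.prems by (intro Suc.IH) auto
  qed
qed

text \<open>The Leibniz rule gives two terms of the same bilinear shape, so the induction closes
  once both functions are generalized. Scaling, multiplication and the inner product are all
  instances.\<close>

lemma Ck_on_bounded_bilinear:
  assumes "open U" "bounded_bilinear b" "Ck_on k U f" "Ck_on k U g"
  shows "Ck_on k U (\<lambda>x. b (f x) (g x))"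
  using assms(3,4)
proof (induction k arbitrary: f g)
  case 0
  then show ?case by (auto intro: bounded_bilinear.continuous_on[OF assms(2)])
next
  case (Suc k)
  show ?case
  proof (rule Ck_on_Suc[OF assms(1)])
    fix x assume "x \<in> U"
    then show "((\<lambda>x. b (f x) (g x)) has_derivative
        (\<lambda>v. b (f x) (frechet_derivative g (at x) v) + b (frechet_derivative f (at x) v) (g x))) (at x)"
      using Suc.prems by (intro bounded_bilinear.FDERIV[OF assms(2)] Ck_on_has_derivative)
  next
    show "Ck_on k U (\<lambda>x. b (f x) (frechet_derivative g (at x) v) +
        b (frechet_derivative f (at x) v) (g x))" for v
      using Suc.prems Ck_on_SucD[OF Suc.prems(1)] Ck_on_SucD[OF Suc.prems(2)]
      by (intro Ck_on_add[OF assms(1)] Suc.IH) auto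
  qed
qed

lemma Ck_on_compose_bounded_linear:
  assumes "open U" "bounded_linear L" "Ck_on k U f"
  shows "Ck_on k U (\<lambda>x. L (f x))"
  using assms(3)
proof (induction k arbitrary: f)
  case 0
  then show ?case by (auto intro: bounded_linear.continuous_on[OF assms(2)])
next
  case (Suc k)
  show ?case
  proof (rule Ck_on_Suc[OF assms(1)])
    fix x assume "x \<in> U"
    then show "((\<lambda>x. L (f x)) has_derivative (\<lambda>v. L (frechet_derivative f (at x) v))) (at x)"
      using Suc.prems by (intro bounded_linear.has_derivative[OF assms(2)] Ck_on_has_derivative)
  next
    show "Ck_on k U (\<lambda>x. L (frechet_derivative f (at x) v))" for v
      using Suc.prems by (intro Suc.IH) auto
  qed
qed

text \<open>With one real variable in the outer function, linearity turns the chain rule into a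
  product of scalar functions, which the bilinear rule handles. Only \<open>h\<close> has to vary in
  the induction.\<close>

lemma Ck_on_compose_real:
  fixes h :: "real \<Rightarrow> real"
  assumes "open U" "Ck_on k S h" "Ck_on k U f" "f ` U \<subseteq> S"
  shows "Ck_on k U (\<lambda>x. h (f x))"
  using assms(2,3)
proof (induction k arbitrary: h)
  case 0
  then show ?case using assms(4) by (auto intro: continuous_on_compose2)
next
  case (Suc k)
  show ?case
  proof (rule Ck_on_Suc[OF assms(1)])
    fix x assume x: "x \<in> U"
    with assms(4) have h: "(h has_derivative frechet_derivative h (at (f x))) (at (f x))"
      using Suc.prems Ck_on_has_derivative by blast
    have "((\<lambda>x. h (f x)) has_derivative
        (\<lambda>v. frechet_derivative h (at (f x)) (frechet_derivative f (at x) v))) (at x)"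
      using has_derivative_compose[OF Ck_on_has_derivative[OF Suc.prems(2) x] h] .
    moreover have "frechet_derivative h (at (f x)) (frechet_derivative f (at x) v)
        = frechet_derivative f (at x) v * frechet_derivative h (at (f x)) 1" for v
      using linear_scale[OF has_derivative_linear[OF h], of "frechet_derivative f (at x) v" 1]
      by simp
    ultimately show "((\<lambda>x. h (f x)) has_derivative
        (\<lambda>v. frechet_derivative f (at x) v * frechet_derivative h (at (f x)) 1)) (at x)"
      by simp
  next
    show "Ck_on k U (\<lambda>x. frechet_derivative f (at x) v * frechet_derivative h (at (f x)) 1)" for v
      using Suc.prems Ck_on_SucD[OF Suc.prems(2)]
        Suc.IH[of "\<lambda>y. frechet_derivative h (at y) 1"]
      by (intro Ck_on_bounded_bilinear[OF assms(1) bounded_bilinear_mult]) simp_all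
  qed
qed

section \<open>Smoothness of all orders\<close>

lemma smooth_on_imp_continuous_on: "smooth_on U f \<Longrightarrow> continuous_on U f"
  unfolding smooth_on_def using Ck_on.simps(1)[of U f] by blast

lemma smooth_on_imp_differentiable: "smooth_on U f \<Longrightarrow> x \<in> U \<Longrightarrow> f differentiable (at x)"
  unfolding smooth_on_def using Ck_on.simps(2)[of 0 U f] by blast

lemma smooth_on_const: "open U \<Longrightarrow> smooth_on U (\<lambda>x. c)"
  by (simp add: smooth_on_def Ck_on_const)

lemma smooth_on_bounded_linear: "open U \<Longrightarrow> bounded_linear f \<Longrightarrow> smooth_on U f"
  by (simp add: smooth_on_def Ck_on_bounded_linear)

lemma smooth_on_add:
  "open U \<Longrightarrow> smooth_on U f \<Longrightarrow> smooth_on U g \<Longrightarrow> smooth_on U (\<lambda>x. f x + g x)"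
  by (simp add: smooth_on_def Ck_on_add)

lemma smooth_on_scaleR:
  "open U \<Longrightarrow> smooth_on U f \<Longrightarrow> smooth_on U g \<Longrightarrow> smooth_on U (\<lambda>x. f x *\<^sub>R g x)"
  by (simp add: smooth_on_def Ck_on_bounded_bilinear[OF _ bounded_bilinear_scaleR])

lemma smooth_on_mult:
  fixes f g :: "_ \<Rightarrow> real"
  shows "open U \<Longrightarrow> smooth_on U f \<Longrightarrow> smooth_on U g \<Longrightarrow> smooth_on U (\<lambda>x. f x * g x)"
  by (simp add: smooth_on_def Ck_on_bounded_bilinear[OF _ bounded_bilinear_mult])

lemma smooth_on_inner:
  "open U \<Longrightarrow> smooth_on U f \<Longrightarrow> smooth_on U g \<Longrightarrow> smooth_on U (\<lambda>x. f x \<bullet> g x)"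
  by (simp add: smooth_on_def Ck_on_bounded_bilinear[OF _ bounded_bilinear_inner])

lemma smooth_on_compose_bounded_linear:
  "open U \<Longrightarrow> bounded_linear L \<Longrightarrow> smooth_on U f \<Longrightarrow> smooth_on U (\<lambda>x. L (f x))"
  unfolding smooth_on_def using Ck_on_compose_bounded_linear by blast

lemma smooth_on_compose_real:
  fixes h :: "real \<Rightarrow> real"
  shows "open U \<Longrightarrow> smooth_on S h \<Longrightarrow> smooth_on U f \<Longrightarrow> f ` U \<subseteq> S \<Longrightarrow> smooth_on U (\<lambda>x. h (f x))"
  unfolding smooth_on_def using Ck_on_compose_real by blast

lemma smooth_on_diff:
  assumes "open U" "smooth_on U f" "smooth_on U g"
  shows "smooth_on U (\<lambda>x. f x - g x)"
  using smooth_on_add[OF assms(1,2) smooth_on_compose_bounded_linear[OF assms(1)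
        bounded_linear_minus[OF bounded_linear_ident] assms(3)]]
  by simp

lemma smooth_on_sum:
  assumes "open U" "\<And>i. i \<in> I \<Longrightarrow> smooth_on U (f i)"
  shows "smooth_on U (\<lambda>x. \<Sum>i\<in>I. f i x)"
  using assms(2)
proof (induction I rule: infinite_finite_induct)
  case (insert i I)
  then show ?case using smooth_on_add[OF assms(1), of "f i" "\<lambda>x. \<Sum>i\<in>I. f i x"] by simp
qed (simp_all add: smooth_on_const[OF assms(1)])

lemma smooth_on_Pair:
  assumes "open U" "smooth_on U f" "smooth_on U g"
  shows "smooth_on U (\<lambda>x. (f x, g x))"
proof -
  have "bounded_linear (\<lambda>x::'b. (x, 0::'c))" "bounded_linear (\<lambda>x::'c. (0::'b, x))"
    by (auto intro!: bounded_linear_Pair bounded_linear_ident bounded_linear_zero)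
  from smooth_on_add[OF assms(1)
      smooth_on_compose_bounded_linear[OF assms(1) this(1) assms(2)]
      smooth_on_compose_bounded_linear[OF assms(1) this(2) assms(3)]]
  show ?thesis by simp
qed

lemma smooth_on_vec:
  fixes f :: "'a::real_normed_vector \<Rightarrow> real ^ 'n"
  assumes "open U" "\<And>j. smooth_on U (\<lambda>x. f x $ j)"
  shows "smooth_on U f"
proof -
  have "f = (\<lambda>x. \<Sum>j\<in>UNIV. (f x $ j) *\<^sub>R axis j 1)"
    by (rule ext) (metis basis_expansion scalar_mult_eq_scaleR)
  moreover have "smooth_on U (\<lambda>x. \<Sum>j\<in>UNIV. (f x $ j) *\<^sub>R (axis j 1 :: real ^ 'n))"
    by (intro smooth_on_sum smooth_on_scaleR smooth_on_const assms)
  ultimately show ?thesis by simp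
qed

text \<open>Bootstrapping: if \<open>f\<close> solves an autonomous equation \<open>f' = F(f)\<close> with \<open>F\<close> smooth,
  each order of differentiability yields the next one.\<close>

lemma smooth_on_ode:
  fixes f F :: "real \<Rightarrow> real"
  assumes "open U" and der: "\<And>x. x \<in> U \<Longrightarrow> (f has_real_derivative F (f x)) (at x)"
    and "smooth_on S F" "f ` U \<subseteq> S"
  shows "smooth_on U f"
  unfolding smooth_on_def
proof
  fix k show "Ck_on k U f"
  proof (induction k)
    case 0
    then show ?case
      using der by (auto intro!: continuous_at_imp_continuous_on DERIV_isCont)
  next
    case (Suc k)
    show ?case
    proof (rule Ck_on_Suc[OF assms(1)])
      show "(f has_derivative (\<lambda>v. F (f x) * v)) (at x)" if "x \<in> U" for x
        using der[OF that] by (simp add: has_field_derivative_def)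
      show "Ck_on k U (\<lambda>x. F (f x) * v)" for v
        using Ck_on_compose_real[OF assms(1) _ Suc assms(4)] assms(1,3)
        by (intro Ck_on_bounded_bilinear[OF _ bounded_bilinear_mult] Ck_on_const)
           (auto simp: smooth_on_def)
    qed
  qed
qed

section \<open>Smoothness of reciprocal, square root and polynomials\<close>

lemma smooth_on_inverse: "smooth_on {0<..} (inverse :: real \<Rightarrow> real)"
proof (rule smooth_on_ode[where F = "\<lambda>y. - (y * y)" and S = UNIV])
  show "(inverse has_real_derivative - (inverse x * inverse x)) (at x)" if "x \<in> {0<..}" for x :: real
    using that DERIV_inverse[of x UNIV] by (auto simp: power2_eq_square)
  have "smooth_on UNIV (\<lambda>y::real. 0 - y * y)"
    by (rule smooth_on_diff[OF open_UNIV smooth_on_const[OF open_UNIV]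
          smooth_on_mult[OF open_UNIV]]; rule smooth_on_bounded_linear[OF open_UNIV bounded_linear_ident])
  then show "smooth_on UNIV (\<lambda>y::real. - (y * y))" by simp
qed auto

text \<open>The square root solves \<open>y' = 1 / (2 y)\<close>, so its smoothness rests on that of
  \<open>inverse\<close>, itself a solution of \<open>y' = - y^2\<close>.\<close>

lemma smooth_on_sqrt: "smooth_on {0<..} sqrt"
proof (rule smooth_on_ode[where F = "\<lambda>y. (1/2) * inverse y" and S = "{0<..}"])
  show "smooth_on {0<..} (\<lambda>y::real. (1/2) * inverse y)"
    by (intro smooth_on_mult smooth_on_const smooth_on_inverse) auto
  show "(sqrt has_real_derivative 1/2 * inverse (sqrt x)) (at x)" if "x \<in> {0<..}" for x
    using that DERIV_real_sqrt[of x] by (simp add: mult.commute)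
qed auto

lemma smooth_on_real_polynomial_function:
  fixes f :: "real \<Rightarrow> real"
  assumes "open U" "real_polynomial_function f"
  shows "smooth_on U f"
  using assms(2)
proof (induction rule: real_polynomial_function.induct)
  case (linear f)
  then show ?case by (rule smooth_on_bounded_linear[OF assms(1)])
next
  case (const c)
  show ?case by (rule smooth_on_const[OF assms(1)])
next
  case (add f g)
  then show ?case by (intro smooth_on_add[OF assms(1)])
next
  case (mult f g)
  then show ?case by (intro smooth_on_mult[OF assms(1)])
qed

section \<open>Cotangent lifts\<close>

text \<open>The form in which duality between \<open>DF q\<close> and \<open>G q\<close> can be
  applied directly to cotangent lifts.\<close>

lemma omega_st_inner: "omega_st v w = fst v \<bullet> snd w - fst w \<bullet> snd v"
  by (simp add: omega_st_def inner_vec_def sum_subtractf mult.commute)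

text \<open>The map \<open>(q, p) \<mapsto> (F q, (DF q)\<^sup>-\<^sup>T p)\<close>. That it is symplectic comes down to the symmetry of
  the second derivative of \<open>F\<close>.\<close>

lemma cotangent_lift_symplectic_embedding:
  fixes F :: "real ^ 'n \<Rightarrow> real ^ 'n" and G :: "real ^ 'n \<Rightarrow> real ^ 'n \<Rightarrow> real ^ 'n"
  assumes "open U" "open V" and U: "\<And>x. x \<in> U \<Longrightarrow> fst x \<in> V"
    and F: "\<And>q. q \<in> V \<Longrightarrow> (F has_derivative DF q) (at q)"
    and DF: "\<And>q v. q \<in> V \<Longrightarrow> ((\<lambda>q. DF q v) has_derivative (\<lambda>u. D2F q u v)) (at q)"
    and sym: "\<And>q u v. q \<in> V \<Longrightarrow> D2F q u v = D2F q v u"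
    and dual: "\<And>q v p. q \<in> V \<Longrightarrow> DF q v \<bullet> G q p = v \<bullet> p"
    and lin: "\<And>q. q \<in> V \<Longrightarrow> linear (G q)"
    and inj: "inj_on F V"
    and smooth: "smooth_on U (\<lambda>x. F (fst x))" "smooth_on U (\<lambda>x. G (fst x) (snd x))"
  shows "open_symplectic_embedding U (\<lambda>x. (F (fst x), G (fst x) (snd x)))"
    (is "open_symplectic_embedding U ?\<Phi>")
proof -
  have smooth_Phi: "smooth_on U ?\<Phi>"
    by (rule smooth_on_Pair[OF \<open>open U\<close> smooth])
  have inj_Phi: "inj_on ?\<Phi> U"
  proof (rule inj_onI)
    fix x y assume x: "x \<in> U" and y: "y \<in> U" and eq: "?\<Phi> x = ?\<Phi> y"
    then have 1: "fst x = fst y"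
      using inj_onD[OF inj, of "fst x" "fst y"] U by simp
    \<comment> \<open>Duality determines the fibre coordinate: pairing \<open>G q p\<close> with
      \<open>DF q v\<close> recovers \<open>v \<bullet> p\<close>.\<close>
    have "v \<bullet> snd x = v \<bullet> snd y" for v
      using dual[of "fst x" v "snd x"] dual[of "fst y" v "snd y"] 1 eq U[OF x] by simp
    then have "snd x = snd y"
      using vector_eq_ldot[of "snd x" "snd y"] by simp
    with 1 show "x = y" by (simp add: prod_eq_iff)
  qed
  \<comment> \<open>Invariance of domain: source and target have equal dimension, so continuity and
    injectivity on an open set suffice.\<close>
  obtain g where "homeomorphism U (?\<Phi> ` U) ?\<Phi> g"
    by (rule invariance_of_domain_homeomorphism[OF \<open>open U\<close>
          smooth_on_imp_continuous_on[OF smooth_Phi] order_refl inj_Phi])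
  then have homeo: "\<exists>g. homeomorphism U (?\<Phi> ` U) ?\<Phi> g"
    by (rule exI[where x = g])
  have "omega_st (frechet_derivative ?\<Phi> (at x) v) (frechet_derivative ?\<Phi> (at x) w) = omega_st v w"
    if x: "x \<in> U" for x v w
  proof -
    define q p where "q = fst x" and "p = snd x"
    have xqp: "x = (q, p)" by (simp add: q_def p_def)
    have q: "q \<in> V" using U[OF x] by (simp add: q_def)
    \<comment> \<open>The total derivative of the fibre part comes from its smoothness. It is split
      into the partial derivative in \<open>p\<close>, which is \<open>G q\<close> by linearity, and
      the one in \<open>q\<close>, called \<open>K\<close>.\<close>
    define H where "H = (\<lambda>x. G (fst x) (snd x))"
    have "H differentiable (at x)"
      using smooth_on_imp_differentiable[OF smooth(2) x] by (simp add: H_def)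
    then obtain H' where H': "(H has_derivative H') (at x)"
      by (auto simp: differentiable_def)
    interpret H': bounded_linear H' using H' by (rule has_derivative_bounded_linear)
    have "(?\<Phi> has_derivative (\<lambda>v. (DF q (fst v), H' v))) (at x)"
    proof (rule has_derivative_Pair)
      have "(F has_derivative DF q) (at (fst x))" using F[OF q] by (simp add: q_def)
      from has_derivative_compose[OF has_derivative_fst[OF has_derivative_ident] this]
      show "((\<lambda>x. F (fst x)) has_derivative (\<lambda>v. DF q (fst v))) (at x)" .
    qed (use H' in \<open>simp add: H_def\<close>)
    then have \<Phi>': "frechet_derivative ?\<Phi> (at x) = (\<lambda>v. (DF q (fst v), H' v))"
      by (rule frechet_derivative_at[symmetric])
    have H2: "H' (0, u) = G q u" for u
    proof -
      have "((\<lambda>p. (q, p)) has_derivative (\<lambda>u. (0, u))) (at p)"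
        by (auto intro!: derivative_eq_intros)
      from has_derivative_compose[OF this, of H H']
      have "((\<lambda>p. H (q, p)) has_derivative (\<lambda>u. H' (0, u))) (at p)"
        using H' by (simp add: xqp)
      moreover have "((\<lambda>p. H (q, p)) has_derivative G q) (at p)"
        using linear_imp_has_derivative[OF lin[OF q]] by (simp add: H_def)
      ultimately show ?thesis by (rule has_derivative_unique[THEN fun_cong])
    qed
    define K where "K = (\<lambda>u. H' (u, 0))"
    have "((\<lambda>q. (q, p)) has_derivative (\<lambda>u. (u, 0))) (at q)"
      by (auto intro!: derivative_eq_intros)
    from has_derivative_compose[OF this, of H H']
    have K: "((\<lambda>q. G q p) has_derivative K) (at q)"
      using H' by (simp add: xqp H_def K_def)
    have H'_split: "H' u = K (fst u) + G q (snd u)" for u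
      using H'.add[of "(fst u, 0)" "(0, snd u)"] H2 by (simp add: K_def)
    \<comment> \<open>Since \<open>DF q u \<bullet> G q p\<close> is constant in \<open>q\<close>,
      differentiating it expresses \<open>K\<close> through the second derivative of
      \<open>F\<close>.\<close>
    have dd: "DF q u \<bullet> K w + D2F q w u \<bullet> G q p = 0" for u w
    proof -
      have "((\<lambda>q. DF q u \<bullet> G q p) has_derivative
          (\<lambda>w. DF q u \<bullet> K w + D2F q w u \<bullet> G q p)) (at q)"
        by (rule has_derivative_inner[OF DF[OF q] K])
      moreover have "((\<lambda>q. DF q u \<bullet> G q p) has_derivative (\<lambda>w. 0)) (at q)"
        by (rule has_derivative_transform_within_open[OF has_derivative_const[of "u \<bullet> p"] \<open>open V\<close> q])
           (simp add: dual)
      ultimately show ?thesis by (rule has_derivative_unique[THEN fun_cong])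
    qed
    \<comment> \<open>By symmetry of \<open>D2F\<close> the terms in the two base components cancel.
      The mixed base and fibre terms are then returned unchanged by \<open>dual\<close>.\<close>
    have "DF q (fst v) \<bullet> K (fst w) = DF q (fst w) \<bullet> K (fst v)"
      using dd[of "fst v" "fst w"] dd[of "fst w" "fst v"] sym[OF q, of "fst v" "fst w"] by simp
    then show ?thesis
      by (simp add: \<Phi>' omega_st_inner H'_split inner_add_right dual[OF q])
  qed
  then show ?thesis
    using \<open>open U\<close> smooth_Phi homeo by (simp add: open_symplectic_embedding_def)
qed

section \<open>Area under the semicircle\<close>

text \<open>Closed form of the integral of \<open>sqrt (1 - u^2)\<close> from 0 to \<open>y\<close>:
  as signed areas, a right triangle plus a circular sector of angle \<open>arcsin y\<close>.\<close>

definition semicircle_area :: "real \<Rightarrow> real" where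
  "semicircle_area y = (y * sqrt (1 - y\<^sup>2) + arcsin y) / 2"

lemma semicircle_area_deriv:
  assumes "-1 < y" "y < 1"
  shows "(semicircle_area has_real_derivative sqrt (1 - y\<^sup>2)) (at y)"
proof -
  have pos: "1 - y\<^sup>2 > 0"
    using assms by (simp add: abs_square_less_1)
  define s where "s = sqrt (1 - y\<^sup>2)"
  have s: "s > 0" "s\<^sup>2 = 1 - y\<^sup>2" using pos by (auto simp: s_def)
  \<comment> \<open>Since \<open>1 - y^2 = s^2\<close>, the last two summands add up to
    \<open>s\<close>.\<close>
  have *: "(s + y * (- y * inverse s) + inverse s) / 2 = s"
    using s by (simp add: field_simps power2_eq_square)
  have "((\<lambda>y. 1 - y\<^sup>2) has_real_derivative - 2 * y) (at y)"
    by (auto intro!: derivative_eq_intros)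
  from DERIV_chain2[OF DERIV_real_sqrt[OF pos] this]
  have "((\<lambda>y. sqrt (1 - y\<^sup>2)) has_real_derivative - y * inverse s) (at y)"
    by (simp add: s_def mult.commute)
  from DERIV_cdivide[OF DERIV_add[OF DERIV_mult[OF DERIV_ident this] DERIV_arcsin[OF assms]], of 2]
  have "(semicircle_area has_real_derivative (s + y * (- y * inverse s) + inverse s) / 2) (at y)"
    by (simp add: semicircle_area_def[abs_def] s_def algebra_simps)
  then show ?thesis
    by (simp only: *) (simp add: s_def)
qed

lemma semicircle_area_continuous_on: "continuous_on {-1..1} semicircle_area"
  unfolding semicircle_area_def[abs_def] by (intro continuous_intros) auto

lemma semicircle_area_0: "semicircle_area 0 = 0"
  by (simp add: semicircle_area_def)

lemma semicircle_area_1: "semicircle_area 1 = pi / 4" "semicircle_area (-1) = - pi / 4"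
  by (simp_all add: semicircle_area_def)

text \<open>The derivative is known and positive only in the open interval; continuity carries
  strict monotonicity to the endpoints.\<close>

lemma semicircle_area_strict_mono:
  assumes "-1 \<le> x" "x < y" "y \<le> 1"
  shows "semicircle_area x < semicircle_area y"
proof (rule DERIV_pos_imp_increasing_open[OF assms(2)])
  show "\<exists>D. (semicircle_area has_real_derivative D) (at z) \<and> D > 0" if "x < z" "z < y" for z
    using that assms by (intro exI[of _ "sqrt (1 - z\<^sup>2)"])
      (auto intro!: semicircle_area_deriv simp: abs_square_less_1)
  show "continuous_on {x..y} semicircle_area"
    by (rule continuous_on_subset[OF semicircle_area_continuous_on]) (use assms in auto)
qed

text \<open>The one-variable inverse function rule. The derivative is written through
  \<open>X x\<close>, so that \<open>X\<close> solves an autonomous equation, as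
  \<open>smooth_on_ode\<close> requires.\<close>

lemma semicircle_area_inverse:
  obtains X where "\<And>x. \<bar>x\<bar> < pi / 4 \<Longrightarrow> \<bar>X x\<bar> < 1"
    and "inj_on X {x. \<bar>x\<bar> < pi / 4}"
    and "\<And>x. \<bar>x\<bar> < pi / 4 \<Longrightarrow> (X has_real_derivative inverse (sqrt (1 - (X x)\<^sup>2))) (at x)"
proof
  define X where "X = inv_into {-1..1} semicircle_area"
  have strict_mono: "strict_mono_on {-1..1} semicircle_area"
    by (intro strict_mono_onI) (use semicircle_area_strict_mono in auto)
  then have inj: "inj_on semicircle_area {-1..1}"
    by (rule strict_mono_on_imp_inj_on)
  have img: "semicircle_area ` {-1..1} = {- pi / 4..pi / 4}"
  proof
    show "semicircle_area ` {-1..1} \<subseteq> {- pi / 4..pi / 4}"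
    proof
      fix z assume "z \<in> semicircle_area ` {-1..1}"
      then obtain y where "-1 \<le> y" "y \<le> 1" "z = semicircle_area y" by auto
      then show "z \<in> {- pi / 4..pi / 4}"
        using strict_mono_on_leD[OF strict_mono, of "-1" y] strict_mono_on_leD[OF strict_mono, of y 1]
          semicircle_area_1 by auto
    qed
    show "{- pi / 4..pi / 4} \<subseteq> semicircle_area ` {-1..1}"
    proof
      fix z assume "z \<in> {- pi / 4..pi / 4}"
      then show "z \<in> semicircle_area ` {-1..1}"
        using IVT'[of semicircle_area "-1" z 1] semicircle_area_continuous_on semicircle_area_1
        by (auto simp: image_iff)
    qed
  qed
  have AX: "semicircle_area (X x) = x" and X1: "\<bar>X x\<bar> \<le> 1" if "\<bar>x\<bar> \<le> pi / 4" for x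
  proof -
    have x: "x \<in> semicircle_area ` {-1..1}"
      using that unfolding img by (auto simp: abs_le_iff)
    show "semicircle_area (X x) = x" "\<bar>X x\<bar> \<le> 1"
      using f_inv_into_f[OF x] inv_into_into[OF x] by (auto simp: X_def)
  qed
  show X: "\<bar>X x\<bar> < 1" if "\<bar>x\<bar> < pi / 4" for x
  proof -
    \<comment> \<open>The areas at 1 and -1 are \<open>pi / 4\<close> and \<open>- pi / 4\<close>,
      outside the open interval.\<close>
    have "X x \<noteq> 1" "X x \<noteq> -1"
      using AX[of x] that semicircle_area_1 by (auto simp: abs_less_iff)
    then show ?thesis using X1[of x] that by linarith
  qed
  show "inj_on X {x. \<bar>x\<bar> < pi / 4}"
    by (rule inj_on_inverseI[of _ semicircle_area]) (simp add: AX)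
  \<comment> \<open>The inverse of a continuous injection on a compact set is continuous.\<close>
  have "continuous_on (semicircle_area ` {-1..1}) X"
    by (rule continuous_on_inv[OF semicircle_area_continuous_on]) (auto simp: X_def inj)
  then have cont: "continuous_on {- pi / 4<..<pi / 4} X"
    unfolding img by (rule continuous_on_subset) auto
  show "(X has_real_derivative inverse (sqrt (1 - (X x)\<^sup>2))) (at x)" if x: "\<bar>x\<bar> < pi / 4" for x
  proof (rule DERIV_inverse_function[where a = "- pi / 4" and b = "pi / 4"])
    show "(semicircle_area has_real_derivative sqrt (1 - (X x)\<^sup>2)) (at (X x))"
      using X[OF x] by (intro semicircle_area_deriv) auto
    show "sqrt (1 - (X x)\<^sup>2) \<noteq> 0"
      using X[OF x] by (simp add: abs_square_eq_1)
    have "x \<in> {- pi / 4<..<pi / 4}" using x by (auto simp: abs_less_iff)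
    then show "isCont X x"
      using cont continuous_on_eq_continuous_at[OF open_greaterThanLessThan] by blast
    show "semicircle_area (X y) = y" if "- pi / 4 < y" "y < pi / 4" for y
      using that by (intro AX) auto
  qed (use x in auto)
qed

text \<open>Integrating a polynomial slightly above \<open>sqrt (1 - r\<^sup>2)\<close> from \<open>0\<close> to \<open>r\<close> gives \<open>r * g (r\<^sup>2)\<close>.\<close>

lemma semicircle_area_polynomial_majorant:
  assumes "pi / 4 < \<alpha>"
  obtains g where "real_polynomial_function g"
    and "\<And>D r. (\<And>s. (g has_real_derivative D s) (at s)) \<Longrightarrow> 0 \<le> r \<Longrightarrow> r \<le> 1 \<Longrightarrow>
            sqrt (1 - r\<^sup>2) < g (r\<^sup>2) + 2 * r\<^sup>2 * D (r\<^sup>2)"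
    and "\<And>r. 0 \<le> r \<Longrightarrow> r \<le> 1 \<Longrightarrow> sqrt (1 - r\<^sup>2) < g (r\<^sup>2)"
    and "g 1 \<le> \<alpha>"
proof -
  define e where "e = \<alpha> - pi / 4"
  have e: "e > 0" using assms by (simp add: e_def)
  \<comment> \<open>Raising the target by \<open>e / 2\<close> and approximating within
    \<open>e / 2\<close> puts \<open>P t\<close> strictly between \<open>sqrt (1 - t)\<close> and
    \<open>sqrt (1 - t) + e\<close>.\<close>
  have "continuous_on {0..1} (\<lambda>t::real. sqrt (1 - t) + e / 2)"
    by (intro continuous_intros)
  then obtain P :: "real \<Rightarrow> real" where P: "real_polynomial_function P"
    and Pe: "\<And>t. t \<in> {0..1} \<Longrightarrow> \<bar>sqrt (1 - t) + e / 2 - P t\<bar> < e / 2"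
    using Stone_Weierstrass_real_polynomial_function[of "{0..1}" "\<lambda>t::real. sqrt (1 - t) + e / 2" "e / 2"] e
    by (metis compact_Icc half_gt_zero)
  obtain a n where P_sum: "P = (\<lambda>t. \<Sum>k\<le>n. a k * t ^ k)"
    using P real_polynomial_function_iff_sum by auto
  \<comment> \<open>Dividing by \<open>2 * k + 1\<close> makes \<open>r * g (r^2)\<close> the
    antiderivative of \<open>P (r^2)\<close> that vanishes at 0.\<close>
  define g where "g = (\<lambda>t. \<Sum>k\<le>n. a k / real (2 * k + 1) * t ^ k)"
  have lower: "sqrt (1 - r\<^sup>2) < P (r\<^sup>2)" and upper: "P (r\<^sup>2) < sqrt (1 - r\<^sup>2) + e"
    if "0 \<le> r" "r \<le> 1" for r
  proof -
    have "r\<^sup>2 \<in> {0..1}" using that power_le_one[of r 2] by simp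
    from Pe[OF this] show "sqrt (1 - r\<^sup>2) < P (r\<^sup>2)" "P (r\<^sup>2) < sqrt (1 - r\<^sup>2) + e"
      by linarith+
  qed
  have h: "((\<lambda>r. r * g (r\<^sup>2)) has_real_derivative P (r\<^sup>2)) (at r)" for r
  proof -
    have pw: "((\<lambda>r. r ^ (2 * k + 1)) has_real_derivative real (2 * k + 1) * r ^ (2 * k)) (at r)" for k
      using DERIV_pow[of "2 * k + 1" r UNIV] by simp
    have "r * g (r\<^sup>2) = (\<Sum>k\<le>n. a k / real (2 * k + 1) * r ^ (2 * k + 1))" for r
      by (simp add: g_def sum_distrib_left power_mult[symmetric] mult_ac)
    moreover have "((\<lambda>r. \<Sum>k\<le>n. a k / real (2 * k + 1) * r ^ (2 * k + 1)) has_real_derivative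
        (\<Sum>k\<le>n. a k / real (2 * k + 1) * (real (2 * k + 1) * r ^ (2 * k)))) (at r)"
      by (intro DERIV_sum DERIV_cmult pw)
    moreover have "(\<Sum>k\<le>n. a k / real (2 * k + 1) * (real (2 * k + 1) * r ^ (2 * k))) = P (r\<^sup>2)"
      unfolding P_sum by (intro sum.cong) (auto simp: power_mult simp del: of_nat_add of_nat_mult of_nat_Suc)
    ultimately show ?thesis by simp
  qed
  show ?thesis
  proof
    show "real_polynomial_function g"
      unfolding g_def real_polynomial_function_iff_sum
      by (intro exI[of _ "\<lambda>k. a k / real (2 * k + 1)"] exI[of _ n]) (rule refl)
  next
    fix D :: "real \<Rightarrow> real" and r :: real
    assume D: "\<And>s. (g has_real_derivative D s) (at s)" and r: "0 \<le> r" "r \<le> 1"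
    \<comment> \<open>The product rule identifies \<open>P (r^2)\<close> with the expression in
      \<open>g\<close> and \<open>D\<close>; uniqueness of derivatives makes the choice of
      \<open>D\<close> immaterial.\<close>
    have "((\<lambda>r. r * g (r\<^sup>2)) has_real_derivative g (r\<^sup>2) + r * (D (r\<^sup>2) * (2 * r))) (at r)"
      by (rule derivative_eq_intros DERIV_chain2[OF D] refl | simp)+
    from DERIV_unique[OF this h[of r]] lower[OF r]
    show "sqrt (1 - r\<^sup>2) < g (r\<^sup>2) + 2 * r\<^sup>2 * D (r\<^sup>2)"
      by (simp add: power2_eq_square algebra_simps)
  next
    fix r :: real
    assume r: "0 \<le> r" "r \<le> 1"
    show "sqrt (1 - r\<^sup>2) < g (r\<^sup>2)"
    proof (cases "r = 0")
      case True
      have "g 0 = P 0" by (simp add: g_def P_sum sum.atMost_shift)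
      then show ?thesis using lower[of 0] True by simp
    next
      case False
      \<comment> \<open>\<open>g (r^2)\<close> is the mean of \<open>P (u^2)\<close> for
        \<open>u\<close> between 0 and \<open>r\<close>, hence equals \<open>P (z^2)\<close> for
        some \<open>z < r\<close>, where the semicircle is at least as high as at
        \<open>r\<close>.\<close>
      then obtain z where z: "0 < z" "z < r" "r * g (r\<^sup>2) - 0 * g (0\<^sup>2) = (r - 0) * P (z\<^sup>2)"
        using MVT2[of 0 r "\<lambda>r. r * g (r\<^sup>2)" "\<lambda>r. P (r\<^sup>2)"] h r by auto
      then have "g (r\<^sup>2) = P (z\<^sup>2)" using False by simp
      moreover have "sqrt (1 - r\<^sup>2) \<le> sqrt (1 - z\<^sup>2)"
        using z power_mono[of z r 2] by simp
      moreover have "sqrt (1 - z\<^sup>2) < P (z\<^sup>2)" using lower[of z] z r by simp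
      ultimately show ?thesis by linarith
    qed
  next
    \<comment> \<open>The derivative of \<open>?k\<close> is
      \<open>sqrt (1 - r^2) + e - P (r^2)\<close>, positive by \<open>upper\<close>, and
      \<open>?k\<close> runs from 0 to \<open>\<alpha> - g 1\<close>.\<close>
    let ?k = "\<lambda>r. semicircle_area r + e * r - r * g (r\<^sup>2)"
    have "?k 0 \<le> ?k 1"
    proof (rule DERIV_nonneg_imp_increasing_open[where f = ?k])
      fix r :: real assume r: "0 < r" "r < 1"
      have "(?k has_real_derivative sqrt (1 - r\<^sup>2) + e - P (r\<^sup>2)) (at r)"
        using DERIV_diff[OF DERIV_add[OF semicircle_area_deriv DERIV_cmult_Id[of e]] h[of r]] r by simp
      with upper[of r] r show "\<exists>D. (?k has_real_derivative D) (at r) \<and> 0 \<le> D"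
        by (intro exI[of _ "sqrt (1 - r\<^sup>2) + e - P (r\<^sup>2)"]) auto
    next
      have "continuous_on {0..1} (\<lambda>r. r * g (r\<^sup>2))"
        using h by (meson DERIV_isCont continuous_at_imp_continuous_on)
      moreover have "continuous_on {0..1} semicircle_area"
        by (rule continuous_on_subset[OF semicircle_area_continuous_on]) auto
      ultimately show "continuous_on {0..1} ?k"
        by (intro continuous_on_diff continuous_on_add continuous_on_mult_left continuous_on_id)
    qed simp
    then show "g 1 \<le> \<alpha>"
      by (simp add: semicircle_area_0 semicircle_area_1 e_def)
  qed
qed

section \<open>Embeddings\<close>

lemma open_symplectic_embedding_imp:
  assumes "open_symplectic_embedding U f" "X \<subseteq> U" "f ` X \<subseteq> Y"
  shows "symplectic_embedding X Y f"
  unfolding symplectic_embedding_def using assms by (intro conjI exI[of _ U] exI[of _ f]) auto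

text \<open>The lift of a linear map, so its second derivative is 0. It changes the ratio of the
  radii but keeps their product.\<close>

lemma dilation_symplectic_embedding:
  assumes "t > 0"
  shows "symplectic_embedding (lagrangian_ball_product a b :: 'n::finite phase set)
    (lagrangian_ball_product (t * a) (b / t)) (\<lambda>x. (t *\<^sub>R fst x, (1 / t) *\<^sub>R snd x))"
    (is "symplectic_embedding ?X ?Y ?f")
proof -
  have "open_symplectic_embedding UNIV ?f"
  proof (rule cotangent_lift_symplectic_embedding[where F = "\<lambda>q. t *\<^sub>R q"
        and G = "\<lambda>q p. (1 / t) *\<^sub>R p" and V = UNIV and DF = "\<lambda>q v. t *\<^sub>R v" and D2F = "\<lambda>_ _ _. 0"])
    show "((*\<^sub>R) t has_derivative (*\<^sub>R) t) (at q)" for q :: "real ^ 'n"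
      by (intro linear_imp_has_derivative) (simp add: linear_iff algebra_simps)
    show "linear ((*\<^sub>R) (1 / t) :: real ^ 'n \<Rightarrow> real ^ 'n)"
      by (simp add: linear_iff algebra_simps)
    show "smooth_on UNIV (\<lambda>x::'n phase. t *\<^sub>R fst x)" "smooth_on UNIV (\<lambda>x::'n phase. (1 / t) *\<^sub>R snd x)"
      by (intro smooth_on_scaleR smooth_on_const smooth_on_bounded_linear bounded_linear_fst
          bounded_linear_snd open_UNIV)+
  qed (use assms in \<open>auto simp: inj_on_def\<close>)
  moreover have "?f ` ?X \<subseteq> ?Y"
    using assms by (auto simp: lagrangian_ball_product_def divide_strict_right_mono)
  ultimately show ?thesis
    by (intro open_symplectic_embedding_imp[where U = UNIV]) auto
qed

section \<open>The unit ball inside products with first radius above \<open>pi / 4\<close>\<close>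

lemma has_derivative_radial:
  fixes q :: "'a::real_inner" and f :: "real \<Rightarrow> real"
  assumes "(f has_real_derivative D) (at (q \<bullet> q))"
  shows "((\<lambda>q. f (q \<bullet> q)) has_derivative (\<lambda>u. 2 * D * (q \<bullet> u))) (at q)"
proof -
  have "((\<lambda>q. q \<bullet> q) has_derivative (\<lambda>u. 2 * (q \<bullet> u))) (at q)"
    by (auto intro!: derivative_eq_intros simp: inner_commute)
  from has_derivative_compose[OF this assms[unfolded has_field_derivative_def]]
  show ?thesis by (simp add: mult_ac)
qed

text \<open>The fibre part is the inverse of \<open>DF q = g(s) + 2 g'(s) q q\<^sup>T\<close>, where \<open>s = |q|\<^sup>2\<close>. The
  eigenvalues of \<open>DF q\<close> are \<open>g(s) + 2 s g'(s)\<close> in the direction of \<open>q\<close> and \<open>g(s)\<close> orthogonally to it.\<close>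

lemma ball_into_lagrangian_ball_product:
  assumes "pi / 4 < \<alpha>"
  shows "\<exists>f. symplectic_embedding (ball 0 1 :: 'n::finite phase set) (lagrangian_ball_product \<alpha> 1) f"
proof -
  obtain g where g_poly: "real_polynomial_function g"
    and eigen1: "\<And>D r. (\<And>s. (g has_real_derivative D s) (at s)) \<Longrightarrow> 0 \<le> r \<Longrightarrow> r \<le> 1 \<Longrightarrow>
            sqrt (1 - r\<^sup>2) < g (r\<^sup>2) + 2 * r\<^sup>2 * D (r\<^sup>2)"
    and eigen2: "\<And>r. 0 \<le> r \<Longrightarrow> r \<le> 1 \<Longrightarrow> sqrt (1 - r\<^sup>2) < g (r\<^sup>2)"
    and g1: "g 1 \<le> \<alpha>"
    using semicircle_area_polynomial_majorant[OF assms] by metis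
  obtain g' where g'_poly: "real_polynomial_function g'"
    and g': "\<And>s. (g has_real_derivative g' s) (at s)"
    using has_real_derivative_polynomial_function[OF g_poly] by blast
  obtain g'' where g'': "\<And>s. (g' has_real_derivative g'' s) (at s)"
    using has_real_derivative_polynomial_function[OF g'_poly] by blast
  \<comment> \<open>The radial eigenvalue of \<open>DF q\<close> at
    \<open>s = q \<bullet> q\<close>, which is also the derivative of \<open>r * g (r^2)\<close> at
    \<open>r = sqrt s\<close>.\<close>
  define P where "P = (\<lambda>s. g s + 2 * s * g' s)"
  have P: "sqrt (1 - s) < P s" and g: "sqrt (1 - s) < g s" if "0 \<le> s" "s \<le> 1" for s
    using eigen1[OF g', of "sqrt s"] eigen2[of "sqrt s"] that by (simp_all add: P_def)
  have Ppos: "P s > 0" and gpos: "g s > 0" if "0 \<le> s" "s \<le> 1" for s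
    using P[of s] g[of s] that real_sqrt_ge_zero[of "1 - s"] by linarith+
  have mono: "r * g (r\<^sup>2) < r' * g (r'\<^sup>2)" if "0 \<le> r" "r < r'" "r' \<le> 1" for r r'
  proof (rule DERIV_pos_imp_increasing[where f = "\<lambda>r. r * g (r\<^sup>2)", OF \<open>r < r'\<close>])
    fix z assume z: "r \<le> z" "z \<le> r'"
    have "((\<lambda>r. r * g (r\<^sup>2)) has_real_derivative g (z\<^sup>2) + z * (g' (z\<^sup>2) * (2 * z))) (at z)"
      by (rule derivative_eq_intros DERIV_chain2[OF g'] refl | simp)+
    also have "g (z\<^sup>2) + z * (g' (z\<^sup>2) * (2 * z)) = P (z\<^sup>2)"
      by (simp add: P_def power2_eq_square)
    finally show "\<exists>y. ((\<lambda>r. r * g (r\<^sup>2)) has_real_derivative y) (at z) \<and> 0 < y"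
      using Ppos[of "z\<^sup>2"] z that power_le_one[of z 2] by auto
  qed
  define F :: "real ^ 'n \<Rightarrow> real ^ 'n" where "F = (\<lambda>q. g (q \<bullet> q) *\<^sub>R q)"
  \<comment> \<open>Inversion of a rank-one perturbation of a multiple of the identity
    (Sherman-Morrison). As \<open>DF q\<close> is symmetric, no transpose appears.\<close>
  define G :: "real ^ 'n \<Rightarrow> real ^ 'n \<Rightarrow> real ^ 'n" where
    "G = (\<lambda>q p. inverse (g (q \<bullet> q)) *\<^sub>R
        (p - (2 * g' (q \<bullet> q) * inverse (P (q \<bullet> q)) * (q \<bullet> p)) *\<^sub>R q))"
  define DF :: "real ^ 'n \<Rightarrow> real ^ 'n \<Rightarrow> real ^ 'n" where
    "DF = (\<lambda>q v. g (q \<bullet> q) *\<^sub>R v + (2 * g' (q \<bullet> q) * (q \<bullet> v)) *\<^sub>R q)"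
  define D2F :: "real ^ 'n \<Rightarrow> real ^ 'n \<Rightarrow> real ^ 'n \<Rightarrow> real ^ 'n" where
    "D2F = (\<lambda>q u v. (2 * g' (q \<bullet> q) * (q \<bullet> u)) *\<^sub>R v + (2 * g' (q \<bullet> q) * (q \<bullet> v)) *\<^sub>R u
        + (2 * g' (q \<bullet> q) * (u \<bullet> v) + 4 * g'' (q \<bullet> q) * (q \<bullet> u) * (q \<bullet> v)) *\<^sub>R q)"
  define f where "f = (\<lambda>x. (F (fst x), G (fst x) (snd x)))"
  have qq: "0 \<le> q \<bullet> q" "q \<bullet> q < 1" if "norm q < 1" for q :: "real ^ 'n"
    using that by (auto simp: dot_square_norm abs_square_less_1)
  have normF: "norm (F q) = norm q * g ((norm q)\<^sup>2)" if "norm q < 1" for q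
    using gpos[of "q \<bullet> q"] qq[OF that] by (simp add: F_def dot_square_norm)
  have dual: "DF q v \<bullet> G q p = v \<bullet> p" if "norm q < 1" for q v p
  proof -
    have nz: "g (q \<bullet> q) \<noteq> 0" "P (q \<bullet> q) \<noteq> 0"
      using gpos[of "q \<bullet> q"] Ppos[of "q \<bullet> q"] qq[OF that] by auto
    define s where "s = q \<bullet> q"
    \<comment> \<open>Because \<open>P s - 2 * s * g' s = g s\<close>, the factor along
      \<open>q\<close> becomes \<open>inverse (P s)\<close>.\<close>
    have "q \<bullet> G q p = inverse (g s) * ((q \<bullet> p) * (inverse (P s) * (P s - 2 * s * g' s)))"
      using nz by (simp add: G_def s_def inner_diff_right algebra_simps)
    also have "\<dots> = inverse (P s) * (q \<bullet> p)"
      using nz by (simp add: P_def s_def)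
    finally have "q \<bullet> G q p = inverse (P s) * (q \<bullet> p)" .
    moreover have "g s * (v \<bullet> G q p) = v \<bullet> p - 2 * g' s * inverse (P s) * (q \<bullet> p) * (q \<bullet> v)"
      using nz by (simp add: G_def s_def inner_diff_right inner_commute)
    ultimately show ?thesis
      by (simp add: DF_def inner_add_left s_def)
  qed
  have "open_symplectic_embedding (ball 0 1) f"
    unfolding f_def
  proof (rule cotangent_lift_symplectic_embedding[where F = F and G = G and V = "ball 0 1" and DF = DF and D2F = D2F])
    show "fst x \<in> ball 0 1" if "x \<in> ball 0 1" for x :: "'n phase"
      using that norm_fst_le[of "fst x" "snd x"] by simp
    show "(F has_derivative DF q) (at q)" for q
      unfolding F_def DF_def
      by (rule has_derivative_eq_rhs[OF has_derivative_scaleR[OF has_derivative_radial[OF g']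
              has_derivative_ident]]) auto
    show "((\<lambda>q. DF q v) has_derivative (\<lambda>u. D2F q u v)) (at q)" for q v
      unfolding D2F_def DF_def
      by (rule has_derivative_eq_rhs[OF has_derivative_add[OF
              has_derivative_scaleR[OF has_derivative_radial[OF g'] has_derivative_const]
              has_derivative_scaleR[OF has_derivative_mult[OF has_derivative_mult[OF has_derivative_const
                has_derivative_radial[OF g'']] has_derivative_inner_left[OF has_derivative_ident]]
              has_derivative_ident]]]) (auto simp: algebra_simps)
    show "D2F q u v = D2F q v u" for q u v
      by (simp add: D2F_def inner_commute algebra_simps)
    show "DF q v \<bullet> G q p = v \<bullet> p" if "q \<in> ball 0 1" for q v p
      using dual that by simp
    show "linear (G q)" for q
      by (simp add: G_def linear_iff inner_add_right algebra_simps)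
    show "inj_on F (ball 0 1)"
    proof (rule inj_onI)
      fix q q' assume q: "q \<in> ball 0 1" and q': "q' \<in> ball 0 1" and eq: "F q = F q'"
      then have "norm q * g ((norm q)\<^sup>2) = norm q' * g ((norm q')\<^sup>2)"
        using normF[of q] normF[of q'] by simp
      \<comment> \<open>The radial profile is strictly increasing, so \<open>F q\<close> determines
        \<open>norm q\<close> and with it the scalar factor of \<open>F\<close>.\<close>
      then have "norm q = norm q'"
        using mono[of "norm q" "norm q'"] mono[of "norm q'" "norm q"] q q'
        by (cases "norm q" "norm q'" rule: linorder_cases) auto
      then have "q \<bullet> q = q' \<bullet> q'" by (simp add: dot_square_norm)
      moreover have "g (q' \<bullet> q') \<noteq> 0"
        using gpos[of "q' \<bullet> q'"] qq[of q'] q' by simp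
      ultimately show "q = q'" using eq by (simp add: F_def)
    qed
    have op: "open (ball 0 1 :: 'n phase set)" by simp
    have sfst: "smooth_on (ball 0 1) (fst :: 'n phase \<Rightarrow> _)"
      and ssnd: "smooth_on (ball 0 1) (snd :: 'n phase \<Rightarrow> _)"
      by (intro smooth_on_bounded_linear bounded_linear_fst bounded_linear_snd op)+
    have ss: "smooth_on (ball 0 1) (\<lambda>x::'n phase. fst x \<bullet> fst x)"
      by (intro smooth_on_inner op sfst)
    have range: "0 \<le> fst x \<bullet> fst x" "fst x \<bullet> fst x \<le> 1" if "x \<in> ball 0 1" for x :: "'n phase"
      using qq[of "fst x"] that norm_fst_le[of "fst x" "snd x"] by auto
    have sg: "smooth_on (ball 0 1) (\<lambda>x::'n phase. g (fst x \<bullet> fst x))"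
      by (rule smooth_on_compose_real[OF op smooth_on_real_polynomial_function[OF open_UNIV g_poly] ss]) auto
    have sg': "smooth_on (ball 0 1) (\<lambda>x::'n phase. g' (fst x \<bullet> fst x))"
      by (rule smooth_on_compose_real[OF op smooth_on_real_polynomial_function[OF open_UNIV g'_poly] ss]) auto
    have sP: "smooth_on (ball 0 1) (\<lambda>x::'n phase. P (fst x \<bullet> fst x))"
      unfolding P_def
      by (rule smooth_on_add[OF op sg smooth_on_mult[OF op smooth_on_mult[OF op smooth_on_const[OF op] ss] sg']])
    have sig: "smooth_on (ball 0 1) (\<lambda>x::'n phase. inverse (g (fst x \<bullet> fst x)))"
      by (rule smooth_on_compose_real[OF op smooth_on_inverse sg]) (use gpos range in auto)
    have siP: "smooth_on (ball 0 1) (\<lambda>x::'n phase. inverse (P (fst x \<bullet> fst x)))"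
      by (rule smooth_on_compose_real[OF op smooth_on_inverse sP]) (use Ppos range in auto)
    show "smooth_on (ball 0 1) (\<lambda>x::'n phase. F (fst x))"
      unfolding F_def by (rule smooth_on_scaleR[OF op sg sfst])
    show "smooth_on (ball 0 1) (\<lambda>x. G (fst x) (snd x))"
      unfolding G_def
      by (rule smooth_on_scaleR[OF op sig smooth_on_diff[OF op ssnd smooth_on_scaleR[OF op
              smooth_on_mult[OF op smooth_on_mult[OF op smooth_on_mult[OF op smooth_on_const[OF op] sg'] siP]
                smooth_on_inner[OF op sfst ssnd]] sfst]]])
  qed auto
  moreover have "f ` ball 0 1 \<subseteq> lagrangian_ball_product \<alpha> 1"
  proof
    fix y assume "y \<in> f ` ball 0 1"
    then obtain q p where y: "y = (F q, G q p)" and "norm (q, p) < 1"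
      by (auto simp: f_def)
    then have qp: "(norm q)\<^sup>2 + (norm p)\<^sup>2 < 1"
      by (simp add: norm_Pair)
    then have "(norm q)\<^sup>2 < 1"
      using zero_le_power2[of "norm p"] by linarith
    then have q: "norm q < 1"
      by (simp add: abs_square_less_1)
    define s w where "s = q \<bullet> q" and "w = G q p"
    have s: "0 \<le> s" "s < 1" using qq[OF q] by (auto simp: s_def)
    have "norm (F q) < \<alpha>"
      using mono[of "norm q" 1] q g1 normF[OF q] by simp
    moreover have "norm w < 1"
    proof -
      \<comment> \<open>Symmetry of \<open>DF q\<close> turns duality into
        \<open>p = DF q w\<close>, so lower bounds on the eigenvalues of \<open>DF q\<close> bound
        \<open>norm w\<close> from above.\<close>
      have "v \<bullet> DF q w = v \<bullet> p" for v
      proof -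
        have "v \<bullet> DF q w = DF q v \<bullet> w"
          by (simp add: DF_def inner_add_left inner_add_right inner_commute)
        then show ?thesis using dual[OF q] by (simp add: w_def)
      qed
      then have p: "p = DF q w" using vector_eq_ldot[of p "DF q w"] by simp
      define c where "c = q \<bullet> w"
      have cs: "c\<^sup>2 \<le> s * (w \<bullet> w)"
        using Cauchy_Schwarz_ineq[of q w] by (simp add: c_def s_def)
      have pp: "p \<bullet> p = (g s)\<^sup>2 * (w \<bullet> w) + 4 * g s * g' s * c\<^sup>2 + 4 * (g' s)\<^sup>2 * s * c\<^sup>2"
        unfolding p DF_def s_def c_def
        by (simp add: inner_add_left inner_add_right inner_commute power2_eq_square algebra_simps)
      have sq: "1 - s \<le> (g s)\<^sup>2" "1 - s \<le> (P s)\<^sup>2"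
        using g[of s] P[of s] s power_mono[of "sqrt (1 - s)" _ 2] by simp_all
      \<comment> \<open>Both squared eigenvalues are at least \<open>1 - s\<close>. The splitting
        along \<open>q\<close> is multiplied through by \<open>s\<close>, which loses all
        information at \<open>s = 0\<close>; that case is separate.\<close>
      have "(1 - s) * (w \<bullet> w) \<le> p \<bullet> p"
      proof (cases "s = 0")
        case True
        then have "c = 0" using cs by simp
        then show ?thesis using pp sq(1) by (simp add: mult_right_mono)
      next
        case False
        then have s0: "s > 0" using s by simp
        \<comment> \<open>Up to the factor \<open>s\<close>, the terms
          \<open>s * (w \<bullet> w) - c^2\<close> and \<open>c^2\<close> are the squared lengths of
          the parts of \<open>w\<close> orthogonal and parallel to \<open>q\<close>. Cauchy-Schwarz
          makes the first nonnegative.\<close>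
        have "s * (p \<bullet> p) = (g s)\<^sup>2 * (s * (w \<bullet> w) - c\<^sup>2) + (P s)\<^sup>2 * c\<^sup>2"
          unfolding pp P_def by (simp add: power2_eq_square algebra_simps)
        also have "\<dots> \<ge> (1 - s) * (s * (w \<bullet> w) - c\<^sup>2) + (1 - s) * c\<^sup>2"
          using cs sq by (intro add_mono mult_right_mono) auto
        finally have "s * ((1 - s) * (w \<bullet> w)) \<le> s * (p \<bullet> p)"
          by (simp add: algebra_simps)
        then show ?thesis using s0 by simp
      qed
      \<comment> \<open>Membership in the unit ball supplies exactly the factor \<open>1 - s\<close>
        of the lower bound.\<close>
      also have "p \<bullet> p < 1 - s"
        using qp by (simp add: s_def dot_square_norm)
      finally have "w \<bullet> w < 1" using s by simp
      then show ?thesis by (simp add: dot_square_norm abs_square_less_1)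
    qed
    ultimately show "y \<in> lagrangian_ball_product \<alpha> 1"
      by (simp add: y w_def lagrangian_ball_product_def)
  qed
  ultimately have "symplectic_embedding (ball 0 1 :: 'n phase set) (lagrangian_ball_product \<alpha> 1) f"
    by (intro open_symplectic_embedding_imp[where U = "ball 0 1"]) auto
  then show ?thesis by (rule exI[where x = f])
qed

section \<open>The product inside the cylinder\<close>

lemma has_derivative_vec:
  fixes f :: "'a::real_normed_vector \<Rightarrow> real ^ 'n"
  assumes "\<And>j. ((\<lambda>x. f x $ j) has_derivative (\<lambda>u. f' u $ j)) (at x)"
  shows "(f has_derivative f') (at x)"
proof (subst has_derivative_componentwise_within, rule ballI)
  fix b :: "real ^ 'n" assume "b \<in> Basis"
  then obtain j where "b = axis j 1" by (auto simp: Basis_vec_def)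
  then show "((\<lambda>x. f x \<bullet> b) has_derivative (\<lambda>u. f' u \<bullet> b)) (at x)"
    using assms[of j] by (simp add: inner_axis)
qed

text \<open>The lift acts on each coordinate pair separately, so it is defined on a box in
  \<open>q\<close> with arbitrary \<open>p\<close>, and only pair \<open>i\<close> matters for the
  target.\<close>

lemma lagrangian_ball_product_into_cylinder:
  "\<exists>f. symplectic_embedding (lagrangian_ball_product (pi / 4) 1 :: 'n::finite phase set)
        (symplectic_cylinder i) f"
proof -
  obtain X where X: "\<And>x. \<bar>x\<bar> < pi / 4 \<Longrightarrow> \<bar>X x\<bar> < 1"
    and X_inj: "inj_on X {x. \<bar>x\<bar> < pi / 4}"
    and X_deriv: "\<And>x. \<bar>x\<bar> < pi / 4 \<Longrightarrow> (X has_real_derivative inverse (sqrt (1 - (X x)\<^sup>2))) (at x)"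
    using semicircle_area_inverse by metis
  define I where "I = {- pi / 4<..<pi / 4}"
  have I: "x \<in> I \<longleftrightarrow> \<bar>x\<bar> < pi / 4" for x by (auto simp: I_def abs_less_iff)
  have "open I" by (simp add: I_def)
  define S where "S = {-1<..<1::real}"
  have S: "y \<in> S \<longleftrightarrow> \<bar>y\<bar> < 1" for y by (auto simp: S_def)
  have "open S" by (simp add: S_def)
  have XS: "X ` I \<subseteq> S" using X by (auto simp: I S)
  \<comment> \<open>\<open>R (X x)\<close> is the reciprocal of the derivative of \<open>X\<close>,
    hence the factor by which the lift multiplies a momentum coordinate.\<close>
  define R where "R = (\<lambda>y::real. sqrt (1 - y\<^sup>2))"
  have Rpos: "R y > 0" if "y \<in> S" for y
    using that by (simp add: R_def S abs_square_less_1)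
  have sid: "smooth_on S (\<lambda>y. y)"
    by (rule smooth_on_bounded_linear[OF \<open>open S\<close> bounded_linear_ident])
  have "smooth_on S (\<lambda>y. 1 - y * y)"
    by (rule smooth_on_diff[OF \<open>open S\<close> smooth_on_const[OF \<open>open S\<close>] smooth_on_mult[OF \<open>open S\<close> sid sid]])
  then have "smooth_on S (\<lambda>y. 1 - y\<^sup>2)" by (simp add: power2_eq_square)
  then have sR: "smooth_on S R"
    unfolding R_def
    by (rule smooth_on_compose_real[OF \<open>open S\<close> smooth_on_sqrt]) (auto simp: S abs_square_less_1)
  have sRi: "smooth_on S (\<lambda>y. inverse (R y))"
    by (rule smooth_on_compose_real[OF \<open>open S\<close> smooth_on_inverse sR]) (use Rpos in auto)
  have X': "(X has_real_derivative inverse (R (X x))) (at x)" if "x \<in> I" for x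
    using X_deriv that by (simp add: I R_def)
  have sX: "smooth_on I X"
    by (rule smooth_on_ode[OF \<open>open I\<close> X' sRi XS])
  have sRX: "smooth_on I (\<lambda>x. R (X x))"
    by (rule smooth_on_compose_real[OF \<open>open I\<close> sR sX XS])
  have sXi: "smooth_on I (\<lambda>x. inverse (R (X x)))"
    by (rule smooth_on_compose_real[OF \<open>open I\<close> sRi sX XS])
  \<comment> \<open>Only existence of the second derivative of \<open>X\<close> matters: the
    diagonal \<open>D2F\<close> is symmetric whatever its entries.\<close>
  have "\<exists>D. ((\<lambda>x. inverse (R (X x))) has_real_derivative D) (at x)" if "x \<in> I" for x
    using smooth_on_imp_differentiable[OF sXi that] unfolding real_differentiable_def .
  then obtain X'' where X'': "\<And>x. x \<in> I \<Longrightarrow> ((\<lambda>x. inverse (R (X x))) has_real_derivative X'' x) (at x)"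
    by metis
  define V :: "(real ^ 'n) set" where "V = (\<Inter>j. (\<lambda>q. q $ j) -` I)"
  have V: "q \<in> V \<longleftrightarrow> (\<forall>j. q $ j \<in> I)" for q by (auto simp: V_def)
  have "open V"
    unfolding V_def by (intro open_INT finite ballI open_vimage \<open>open I\<close> continuous_on_component continuous_on_id)
  define U :: "'n phase set" where "U = fst -` V"
  have "open U" unfolding U_def by (rule open_vimage_fst[OF \<open>open V\<close>])
  define F :: "real ^ 'n \<Rightarrow> real ^ 'n" where "F = (\<lambda>q. \<chi> j. X (q $ j))"
  define G :: "real ^ 'n \<Rightarrow> real ^ 'n \<Rightarrow> real ^ 'n" where "G = (\<lambda>q p. \<chi> j. R (X (q $ j)) * p $ j)"
  define DF :: "real ^ 'n \<Rightarrow> real ^ 'n \<Rightarrow> real ^ 'n" where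
    "DF = (\<lambda>q v. \<chi> j. inverse (R (X (q $ j))) * v $ j)"
  define D2F :: "real ^ 'n \<Rightarrow> real ^ 'n \<Rightarrow> real ^ 'n \<Rightarrow> real ^ 'n" where
    "D2F = (\<lambda>q u v. \<chi> j. X'' (q $ j) * u $ j * v $ j)"
  define f where "f = (\<lambda>x. (F (fst x), G (fst x) (snd x)))"
  have component: "((\<lambda>q::real ^ 'n. q $ j) has_derivative (\<lambda>u. u $ j)) (at q)" for j q
    by (rule bounded_linear_imp_has_derivative[OF bounded_linear_vec_nth])
  have "open_symplectic_embedding U f"
    unfolding f_def
  proof (rule cotangent_lift_symplectic_embedding[where F = F and G = G and V = V and DF = DF and D2F = D2F])
    show "open U" "open V" by fact+
    show "fst x \<in> V" if "x \<in> U" for x using that by (simp add: U_def)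
    show "(F has_derivative DF q) (at q)" if "q \<in> V" for q
    proof (rule has_derivative_vec)
      fix j
      have "(X has_derivative (\<lambda>t. inverse (R (X (q $ j))) * t)) (at (q $ j))"
        using X'[of "q $ j"] that by (simp add: V has_field_derivative_def)
      from has_derivative_compose[OF component this]
      show "((\<lambda>q. F q $ j) has_derivative (\<lambda>u. DF q u $ j)) (at q)"
        by (simp add: F_def DF_def)
    qed
    show "((\<lambda>q. DF q v) has_derivative (\<lambda>u. D2F q u v)) (at q)" if "q \<in> V" for q v
    proof (rule has_derivative_vec)
      fix j
      have "((\<lambda>x. inverse (R (X x))) has_derivative (\<lambda>t. X'' (q $ j) * t)) (at (q $ j))"
        using X''[of "q $ j"] that by (simp add: V has_field_derivative_def)
      from has_derivative_mult_left[OF has_derivative_compose[OF component this], of "v $ j"]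
      show "((\<lambda>q. DF q v $ j) has_derivative (\<lambda>u. D2F q u v $ j)) (at q)"
        by (simp add: DF_def D2F_def)
    qed
    show "D2F q u v = D2F q v u" for q u v
      by (simp add: D2F_def mult_ac)
    show "DF q v \<bullet> G q p = v \<bullet> p" if "q \<in> V" for q v p
    proof -
      have "inverse (R (X (q $ j))) * v $ j * (R (X (q $ j)) * p $ j) = v $ j * p $ j" for j
      proof -
        have "X (q $ j) \<in> S" using XS that by (auto simp: V)
        from Rpos[OF this] show ?thesis by (simp add: field_simps)
      qed
      then show ?thesis by (simp only: inner_vec_def DF_def G_def vec_lambda_beta inner_real_def)
    qed
    show "linear (G q)" for q
      by (simp add: G_def linear_iff vec_eq_iff algebra_simps)
    show "inj_on F V"
    proof (rule inj_onI)
      fix q q' assume "q \<in> V" "q' \<in> V" and eq: "F q = F q'"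
      then have "\<bar>q $ j\<bar> < pi / 4" "\<bar>q' $ j\<bar> < pi / 4" for j
        by (simp_all add: V I)
      moreover have "X (q $ j) = X (q' $ j)" for j
        using eq by (simp add: F_def vec_eq_iff)
      ultimately show "q = q'"
        using inj_onD[OF X_inj] by (simp add: vec_eq_iff)
    qed
    have sfst: "smooth_on U (\<lambda>x::'n phase. fst x $ j)" and ssnd: "smooth_on U (\<lambda>x::'n phase. snd x $ j)" for j
      by (intro smooth_on_bounded_linear[OF \<open>open U\<close>]
          bounded_linear_compose[OF bounded_linear_vec_nth bounded_linear_fst]
          bounded_linear_compose[OF bounded_linear_vec_nth bounded_linear_snd])+
    have U_range: "(\<lambda>x. fst x $ j) ` U \<subseteq> I" for j by (auto simp: U_def V)
    show "smooth_on U (\<lambda>x. F (fst x))"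
    proof (rule smooth_on_vec[OF \<open>open U\<close>])
      show "smooth_on U (\<lambda>x. F (fst x) $ j)" for j
        using smooth_on_compose_real[OF \<open>open U\<close> sX sfst U_range] by (simp add: F_def)
    qed
    show "smooth_on U (\<lambda>x. G (fst x) (snd x))"
    proof (rule smooth_on_vec[OF \<open>open U\<close>])
      show "smooth_on U (\<lambda>x. G (fst x) (snd x) $ j)" for j
        using smooth_on_mult[OF \<open>open U\<close> smooth_on_compose_real[OF \<open>open U\<close> sRX sfst U_range] ssnd]
        by (simp add: G_def)
    qed
  qed
  moreover have "lagrangian_ball_product (pi / 4) 1 \<subseteq> U"
  proof
    fix x :: "'n phase" assume "x \<in> lagrangian_ball_product (pi / 4) 1"
    then have x: "norm (fst x) < pi / 4" by (auto simp: lagrangian_ball_product_def)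
    have "\<bar>fst x $ j\<bar> < pi / 4" for j
      using x component_le_norm_cart[of "fst x" j] by linarith
    then show "x \<in> U" by (simp add: U_def V I)
  qed
  moreover have "f ` lagrangian_ball_product (pi / 4) 1 \<subseteq> symplectic_cylinder i"
  proof
    fix y assume "y \<in> f ` lagrangian_ball_product (pi / 4) 1"
    then obtain q p where y: "y = (F q, G q p)" and q: "norm q < pi / 4" and p: "norm p < 1"
      by (auto simp: f_def lagrangian_ball_product_def)
    define t where "t = X (q $ i)"
    have "\<bar>q $ i\<bar> < pi / 4" using q component_le_norm_cart[of q i] by linarith
    then have t: "1 - t\<^sup>2 > 0" using X by (simp add: t_def abs_square_less_1)
    have "\<bar>p $ i\<bar> < 1" using p component_le_norm_cart[of p i] by linarith
    then have "(p $ i)\<^sup>2 < 1" by (simp add: abs_square_less_1)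
    \<comment> \<open>The sum to be bounded is \<open>t^2\<close> plus \<open>1 - t^2\<close> times
      the square of \<open>p $ i\<close>, which is below \<open>t^2 + (1 - t^2) = 1\<close>.\<close>
    then have "(1 - t\<^sup>2) * (p $ i)\<^sup>2 < 1 - t\<^sup>2" using t by simp
    moreover have "(G q p $ i)\<^sup>2 = (1 - t\<^sup>2) * (p $ i)\<^sup>2"
      using t by (simp add: G_def R_def power_mult_distrib flip: t_def)
    ultimately show "y \<in> symplectic_cylinder i"
      by (simp add: y symplectic_cylinder_def F_def flip: t_def)
  qed
  ultimately have "symplectic_embedding (lagrangian_ball_product (pi / 4) 1) (symplectic_cylinder i) f"
    by (rule open_symplectic_embedding_imp)
  then show ?thesis by (rule exI[where x = f])
qed

section \<open>Capacities of Lagrangian products of balls\<close>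

lemma scaleR_lagrangian_ball_product:
  assumes "s > 0"
  shows "(\<lambda>x. s *\<^sub>R x) ` lagrangian_ball_product a b = lagrangian_ball_product (s * a) (s * b)"
proof (rule set_eqI)
  fix y
  have "y \<in> (\<lambda>x. s *\<^sub>R x) ` lagrangian_ball_product a b \<longleftrightarrow>
      (1 / s) *\<^sub>R y \<in> lagrangian_ball_product a b"
    using assms by (auto simp: image_iff intro!: bexI[of _ "(1 / s) *\<^sub>R y"])
  also have "\<dots> \<longleftrightarrow> y \<in> lagrangian_ball_product (s * a) (s * b)"
    using assms by (cases y) (simp add: lagrangian_ball_product_def field_simps)
  finally show "y \<in> (\<lambda>x. s *\<^sub>R x) ` lagrangian_ball_product a b \<longleftrightarrow>
      y \<in> lagrangian_ball_product (s * a) (s * b)" .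
qed

context
  fixes i :: "'n::finite" and c :: "'n phase set \<Rightarrow> ennreal"
  assumes cap: "normalized_symplectic_capacity i c"
begin

lemma capacity_mono: "symplectic_embedding X Y f \<Longrightarrow> c X \<le> c Y"
  using cap unfolding normalized_symplectic_capacity_def by blast

lemma capacity_scaleR: "s > 0 \<Longrightarrow> c ((\<lambda>x. s *\<^sub>R x) ` X) = ennreal (s\<^sup>2) * c X"
  using cap unfolding normalized_symplectic_capacity_def by blast

lemma capacity_ball: "c (ball 0 1) = ennreal pi"
  and capacity_cylinder: "c (symplectic_cylinder i) = ennreal pi"
  using cap unfolding normalized_symplectic_capacity_def by blast+

text \<open>Dilations by \<open>t\<close> and by \<open>1 / t\<close> are mutually inverse
  embeddings and give the two inequalities.\<close>

lemma capacity_lagrangian_ball_product_dilation: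
  assumes "t > 0"
  shows "c (lagrangian_ball_product (t * a) (b / t)) = c (lagrangian_ball_product a b)"
proof (rule antisym)
  show "c (lagrangian_ball_product a b) \<le> c (lagrangian_ball_product (t * a) (b / t))"
    by (rule capacity_mono[OF dilation_symplectic_embedding[OF assms]])
  have "1 / t > 0" using assms by simp
  from capacity_mono[OF dilation_symplectic_embedding[OF this, of "t * a" "b / t"]]
  show "c (lagrangian_ball_product (t * a) (b / t)) \<le> c (lagrangian_ball_product a b)"
    using assms by simp
qed

lemma capacity_lagrangian_ball_product_ratio:
  assumes "a > 0" "b > 0" "a' > 0" "b' > 0"
  shows "c (lagrangian_ball_product a b) =
    ennreal (a * b / (a' * b')) * c (lagrangian_ball_product a' b')"
proof -
  \<comment> \<open>\<open>s\<close> and \<open>t\<close> are to satisfy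
    \<open>s * t * a' = a\<close> and \<open>s * b' / t = b\<close>. Multiplying the equations gives
    \<open>s\<close>, and the first then gives \<open>t\<close>.\<close>
  define s where "s = sqrt (a * b / (a' * b'))"
  have s: "s > 0" and s2: "s\<^sup>2 = a * b / (a' * b')" using assms by (simp_all add: s_def)
  define t where "t = a / (s * a')"
  have t: "t > 0" using assms s by (simp add: t_def)
  have "s * (t * a') = a" using assms s by (simp add: t_def)
  moreover have "s * (b' / t) = b"
  proof -
    have "s * (b' / t) = s\<^sup>2 * (a' * b') / a"
      by (simp add: t_def power2_eq_square mult_ac)
    then show ?thesis using assms by (simp add: s2)
  qed
  ultimately have "lagrangian_ball_product a b =
      (\<lambda>x. s *\<^sub>R x) ` (lagrangian_ball_product (t * a') (b' / t) :: 'n phase set)"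
    by (simp add: scaleR_lagrangian_ball_product[OF s])
  then have "c (lagrangian_ball_product a b) =
      ennreal (s\<^sup>2) * c (lagrangian_ball_product (t * a') (b' / t))"
    using capacity_scaleR[OF s] by simp
  then show ?thesis
    by (simp add: capacity_lagrangian_ball_product_dilation[OF t] s2)
qed

text \<open>The cylinder gives the upper bound at these exact radii. The ball embedding is available
  only for \<open>\<alpha> > pi / 4\<close>, so the lower bound is a limit, taken by
  contradiction.\<close>

lemma capacity_lagrangian_ball_product_quarter_pi:
  "c (lagrangian_ball_product (pi / 4) 1) = ennreal pi"
proof -
  obtain f where "symplectic_embedding (lagrangian_ball_product (pi / 4) 1) (symplectic_cylinder i) f"
    using lagrangian_ball_product_into_cylinder by blast
  from capacity_mono[OF this] have "c (lagrangian_ball_product (pi / 4) 1) \<le> ennreal pi"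
    by (simp only: capacity_cylinder)
  moreover from this obtain r where r: "r \<ge> 0" "c (lagrangian_ball_product (pi / 4) 1) = ennreal r"
    by (cases "c (lagrangian_ball_product (pi / 4) 1)" rule: ennreal_cases) (auto simp: top_unique)
  moreover have "pi \<le> r"
  proof (rule ccontr)
    assume "\<not> pi \<le> r"
    \<comment> \<open>With \<open>r'\<close> strictly between \<open>r\<close> and
      \<open>pi\<close>, the choice of \<open>\<alpha>\<close> makes
      \<open>\<alpha> / (pi / 4) = pi / r'\<close>. The ball embedding then forces
      \<open>pi \<le> pi * r / r'\<close>, although \<open>r < r'\<close>.\<close>
    define r' where "r' = (r + pi) / 2"
    have r': "0 < r'" "r < r'" "r' < pi" using r(1) \<open>\<not> pi \<le> r\<close> by (auto simp: r'_def)
    define \<alpha> where "\<alpha> = pi * pi / (4 * r')"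
    have \<alpha>: "pi / 4 < \<alpha>" using r' by (simp add: \<alpha>_def field_simps)
    obtain f where "symplectic_embedding (ball 0 1 :: 'n phase set) (lagrangian_ball_product \<alpha> 1) f"
      using ball_into_lagrangian_ball_product[OF \<alpha>] by blast
    from capacity_mono[OF this] have "ennreal pi \<le> c (lagrangian_ball_product \<alpha> 1)"
      by (simp only: capacity_ball)
    also have "\<dots> = ennreal (\<alpha> / (pi / 4)) * ennreal r"
    proof -
      have "\<alpha> > 0" using \<alpha> pi_gt_zero by linarith
      then show ?thesis
        using capacity_lagrangian_ball_product_ratio[of \<alpha> 1 "pi / 4" 1] r(2) by simp
    qed
    also have "\<dots> = ennreal (pi * r / r')"
      using r(1) r' by (simp add: \<alpha>_def ennreal_mult[symmetric] field_simps)
    finally have "pi \<le> pi * r / r'" using r(1) r' by (simp add: ennreal_le_iff)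
    then show False using r' by (simp add: field_simps)
  qed
  ultimately show ?thesis by (simp add: antisym ennreal_le_iff)
qed

text \<open>The value is \<open>4 * a * b\<close>. It involves neither \<open>c\<close> nor
  \<open>i\<close>, which is what makes any two capacities agree.\<close>

lemma capacity_lagrangian_ball_product:
  assumes "a > 0" "b > 0"
  shows "c (lagrangian_ball_product a b) = ennreal (a * b / (pi / 4)) * ennreal pi"
  using capacity_lagrangian_ball_product_ratio[OF assms, of "pi / 4" 1]
  by (simp add: capacity_lagrangian_ball_product_quarter_pi)

end

theorem proposition1p6:
  fixes a b :: real
    and i :: "'n::finite"
    and c c' :: "((real ^ 'n) \<times> (real ^ 'n)) set \<Rightarrow> ennreal"
  assumes "a > 0" and "b > 0"
    and "normalized_symplectic_capacity i c"
    and "normalized_symplectic_capacity i c'"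
  shows "c (lagrangian_ball_product a b) = c' (lagrangian_ball_product a b)"
  using assms by (simp add: capacity_lagrangian_ball_product)

end
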